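(* Assume that $\mu(\mathcal M,W)<\infty$, and that $B(\xi)$ is linear for all $\xi\in\mathcal P$ with constants $0<c\le C<\infty$ such that $$c\le\min_{v\in U\setminus\{0\}}\frac{\|B(\xi)v\|_{U'}}{\|v\|_U}\le\max_{v\in U\setminus\{0\}}\frac{\|B(\xi)v\|_{U'}}{\|v\|_U}\le C\qquad\text{for all }\xi\in\mathcal P.$$ Assume moreover that one of the following holds: (i) $\widetilde{\mathcal P}\subset\mathcal P$ is a finite (possibly very large) set of parameters, $\#\widetilde{\mathcal P}<\infty$, and $\Theta$ is a $(\epsilon,(\#\widetilde{\mathcal P})^{-1}\delta,1)$ oblivious $U\to\ell_2$ subspace embedding; or (ii) $B(\xi)=B^{(0)}+\sum_{q=1}^{m_B}\theta^B_q(\xi)B^{(q)}$ and $f(\xi)=f^{(0)}+\sum_{q=1}^{m_f}\theta^f_q(\xi)f^{(q)}$ for all $\xi\in\mathcal P$, with $\theta^B_q,\theta^f_q:\mathcal P\to\mathbb R$ and parameter-independent $B^{(q)}:U\to U'$, $f^{(q)}\in U'$, and $\Theta$ is a $(\epsilon,\delta,m_B+m_f+1)$ oblivious $U\to\ell_2$ subspace embedding. Then for any $u\in\mathcal M$ and $w=P_Wu$, with probability at least $1-\delta N_{\mathrm{LARS}}$, $$\|u-A^{\mathrm{dic}}_{\mathcal S^{\Theta}}(w)\|_U\ \le\ \delta_0+2\,\kappa^{\Theta}\,\mu(\mathcal M,W)\,\min_{V\in\hat{\mathcal L}(w)}\|u-A_V(w)\|_U,$$ where $\kappa^{\Theta}:=\kappa\sqrt{1+\epsilon}/\sqrt{1-\epsilon}$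 and $\kappa:=C/c$.
   Context: **Space.** $U$ is a real Hilbert space of finite dimension $\mathcal N$. Both $U$ and its dual $U'$ are identified with $\mathbb R^{\mathcal N}$, with inner products $\langle x,y\rangle_U=x^{T}\mathbf R_U y$ and $\langle x,y\rangle_{U'}=x^{T}\mathbf R_U^{-1}y$, where $\mathbf R_U\in\mathbb R^{\mathcal N\times\mathcal N}$ is symmetric positive definite (the matrix of the Riesz map). $W\subset U$ is a subspace of dimension $m$ (observation space), $W^\perp$ its orthogonal complement and $P_W$ the orthogonal projection onto $W$ in $U$. **Equation and manifold.** $\mathcal P$ is a (nonempty, possibly infinite) parameter set. For each $\xi\in\mathcal P$ there are $B(\xi):U\to U'$ and $f(\xi)\in U'$, and $u(\xi)\in U$ is the solution of $B(\xi)u(\xi)=f(\xi)$. The solution manifold is $\mathcal M=\{u(\xi):\xi\in\mathcal P\}$. Set $\mathrm{dist}(v,\mathcal M)=\inf_{z\in\mathcal M}\|v-z\|_U$ and $r(v,\xi):=B(\xi)v-f(\xi)$. **Sketching.** $\Theta$ is a linear map $U\to\mathbb R^k$ given by a random matrix $\mathbf\Theta\in\mathbb R^{k\times\mathcal N}$. It defines $\|v\|_U^{\Theta}:=\|\mathbf\Theta v\|_2$ for $v\in U$ and $\|r\|_{U'}^{\Theta}:=\|\mathbf\Theta\mathbf R_U^{-1}r\|_2$ for $r\in U'$. For $\epsilon\in[0,1)$, $\Theta$ is a $U\to\ell_2$ $\epsilon$-subspace embedding for a subspace $Y\subset U$ if $\big|\|v\|_U^2-(\|v\|_U^{\Theta})^2\big|\le\epsilon\|v\|_U^2$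 for all $v\in Y$. $\Theta$ is a $(\epsilon,\delta,d)$ oblivious $U\to\ell_2$ subspace embedding if for every (fixed) $d$-dimensional subspace $Y\subset U$, $\mathbb P(\Theta\text{ is a }U\to\ell_2\ \epsilon\text{-subspace embedding for }Y)\ge1-\delta$. The value of $d$ used is understood to be at most $\mathcal N$. **Sketched residual-based distance.** $\mathcal S^{\Theta}(v,\mathcal P):=\min_{\xi\in\mathcal P}\|r(v,\xi)\|_{U'}^{\Theta}$ (an infimum if not attained). **One-space recovery.** For a subspace $V\subset U$ with $V\cap W^\perp=\{0\}$ and $w\in W$, $A_V(w):=v^*+\eta^*$ with $v^*:=\arg\min_{v\in V}\|w-P_Wv\|_U$ and $\eta^*:=w-P_Wv^*$. **Dictionary library.** $\mathcal D_K=\{v^{(1)},\dots,v^{(K)}\}\subset U$ is a (deterministic) dictionary of vectors with $\|v^{(k)}\|_U=1$. $\mathbf V\in\mathbb R^{\mathcal N\times K}$ is the matrix with columns $v^{(k)}$, $\mathbf W\in\mathbb R^{\mathcal N\times m}$ is a matrix whose columns form a $U$-orthonormal basis of $W$, and $\mathbf C:=\mathbf W^{T}\mathbf R_U\mathbf V\in\mathbb R^{m\times K}$. For $w\in W$, $\mathbf w\in\mathbb R^m$ is defined by $w=\mathbf W\mathbf w$. Standing assumption: for all $\alpha>0$ the problem $\min_{\mathbf x\in\mathbb R^K}\frac12\|\mathbf C\mathbf x-\mathbf w\|_2^2+\alpha\|\mathbf x\|_1$ has a unique solution, denoted $\mathbf x^*_\alpha(w)$ (it then has at most $m$ nonzero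 entries). Set $V_\alpha(w):=\mathrm{span}\{v^{(i)}:\mathbf x^*_\alpha(w)_i\ne0\}$. For some threshold $\alpha_0(w)>0$ (depending on $w$ but not on $\Theta$), $\hat{\mathcal L}(w):=\{V_\alpha(w):\alpha>\alpha_0(w)\}$, chosen so that $\#\hat{\mathcal L}(w)\le N_{\mathrm{LARS}}$, where $N_{\mathrm{LARS}}$ is a prescribed integer. **Dictionary-based recovery.** $A^{\mathrm{dic}}_{\mathcal S^{\Theta}}(w):=A_{V^*}(w)$ where $V^*\in\arg\min_{V\in\hat{\mathcal L}(w)}\mathcal S^{\Theta}(A_V(w),\mathcal P)$. **Stability constant.** For $\sigma\ge0$, $\mathcal M_\sigma:=\{v\in U:\mathrm{dist}(v,\mathcal M)\le\sigma\}$, $U_w:=w+W^\perp$, $\delta_\sigma:=\max_{w\in W}\mathrm{diam}(\mathcal M_\sigma\cap U_w)$ (a supremum if not attained), and $\mu(\mathcal M,W):=\frac12\sup_{\sigma>0}\frac{\delta_\sigma-\delta_0}{\sigma}$. (The number $\delta_0$ is distinct from the failure probability parameter $\delta$.)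
   Formalization: In case (i) the sketched distance is minimised over the finite set P̃ instead of P and u ranges over u(P̃) instead of all of M (δ_0 and μ still use all of M); with P infinite and only #P̃ controlled, the claim as written is false. *)

theory Defs
  imports "HOL-Probability.Probability"
begin

text \<open>
  The space \<open>U\<close> and its dual \<open>U'\<close> are both the type \<open>real^'n\<close>, with the inner products given by
  the Riesz matrix \<open>R\<close> and by its inverse. The norms and the orthogonality of the type itself
  are the Euclidean ones and are only used for coefficient vectors and for sketches.
\<close>

definition spd :: "real^'n^'n \<Rightarrow> bool" where
  "spd R \<longleftrightarrow> transpose R = R \<and> (\<forall>x. x \<noteq> 0 \<longrightarrow> 0 < x \<bullet> (R *v x))"

definition innerU :: "real^'n^'n \<Rightarrow> real^'n \<Rightarrow> real^'n \<Rightarrow> real" where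
  "innerU R x y = x \<bullet> (R *v y)"

definition normU :: "real^'n^'n \<Rightarrow> real^'n \<Rightarrow> real" where
  "normU R x = sqrt (innerU R x x)"

definition norm_dual :: "real^'n^'n \<Rightarrow> real^'n \<Rightarrow> real" where
  "norm_dual R r = sqrt (r \<bullet> (matrix_inv R *v r))"

definition orthU :: "real^'n^'n \<Rightarrow> (real^'n) set \<Rightarrow> (real^'n) set" where
  "orthU R W = {x. \<forall>y\<in>W. innerU R x y = 0}"

definition projU :: "real^'n^'n \<Rightarrow> (real^'n) set \<Rightarrow> real^'n \<Rightarrow> real^'n" where
  "projU R W x = (THE p. p \<in> W \<and> x - p \<in> orthU R W)"

definition distU :: "real^'n^'n \<Rightarrow> real^'n \<Rightarrow> (real^'n) set \<Rightarrow> real" where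
  "distU R v M = (INF z\<in>M. normU R (v - z))"


subsection \<open>Sketching\<close>

definition subspace_embedding ::
  "real^'n^'n \<Rightarrow> real \<Rightarrow> real^'n^'k \<Rightarrow> (real^'n) set \<Rightarrow> bool" where
  "subspace_embedding R \<epsilon> \<Theta> Y \<longleftrightarrow>
     (\<forall>v\<in>Y. \<bar>(normU R v)\<^sup>2 - (norm (\<Theta> *v v))\<^sup>2\<bar> \<le> \<epsilon> * (normU R v)\<^sup>2)"

text \<open>
  A random matrix is a matrix-valued function on the sample space of \<open>Pr\<close>. Without the bound
  on \<open>d\<close> the condition would be vacuous for \<open>d\<close> larger than the dimension of \<open>U\<close>.
\<close>

definition oblivious_embedding ::
  "real^'n^'n \<Rightarrow> 'w measure \<Rightarrow> ('w \<Rightarrow> real^'n^'k) \<Rightarrow> real \<Rightarrow> real \<Rightarrow> nat \<Rightarrow> bool" where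
  "oblivious_embedding R Pr \<Theta> \<epsilon> \<delta> d \<longleftrightarrow>
     d \<le> CARD('n) \<and>
     (\<forall>Y. subspace Y \<and> dim Y = d \<longrightarrow>
        \<P>(\<omega> in Pr. subspace_embedding R \<epsilon> (\<Theta> \<omega>) Y) \<ge> 1 - \<delta>)"

definition sketched_norm_dual :: "real^'n^'n \<Rightarrow> real^'n^'k \<Rightarrow> real^'n \<Rightarrow> real" where
  "sketched_norm_dual R \<Theta> r = norm (\<Theta> *v (matrix_inv R *v r))"

text \<open>The set \<open>Q\<close> of parameters over which the sketched residual is minimised is an argument.\<close>

definition sketched_dist ::
  "real^'n^'n \<Rightarrow> real^'n^'k \<Rightarrow> ('p \<Rightarrow> real^'n \<Rightarrow> real^'n) \<Rightarrow> ('p \<Rightarrow> real^'n) \<Rightarrow>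
   'p set \<Rightarrow> real^'n \<Rightarrow> real" where
  "sketched_dist R \<Theta> B f Q v = (INF \<xi>\<in>Q. sketched_norm_dual R \<Theta> (B \<xi> v - f \<xi>))"

definition affine_parametrization ::
  "'p set \<Rightarrow> ('p \<Rightarrow> real^'n \<Rightarrow> real^'n) \<Rightarrow> ('p \<Rightarrow> real^'n) \<Rightarrow> nat \<Rightarrow> nat \<Rightarrow> bool" where
  "affine_parametrization P B f mB mf \<longleftrightarrow>
     (\<exists>(Bq :: nat \<Rightarrow> real^'n \<Rightarrow> real^'n) (fq :: nat \<Rightarrow> real^'n)
       (\<theta>B :: nat \<Rightarrow> 'p \<Rightarrow> real) (\<theta>f :: nat \<Rightarrow> 'p \<Rightarrow> real).
        \<forall>\<xi>\<in>P. (\<forall>v. B \<xi> v = Bq 0 v + (\<Sum>q=1..mB. \<theta>B q \<xi> *\<^sub>R Bq q v)) \<and>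
               f \<xi> = fq 0 + (\<Sum>q=1..mf. \<theta>f q \<xi> *\<^sub>R fq q))"


subsection \<open>Recovery from one space and from a dictionary\<close>

definition one_space_recovery ::
  "real^'n^'n \<Rightarrow> (real^'n) set \<Rightarrow> (real^'n) set \<Rightarrow> real^'n \<Rightarrow> real^'n" where
  "one_space_recovery R W V w =
     (let v = arg_min_on (\<lambda>v. normU R (w - projU R W v)) V in v + (w - projU R W v))"

definition lasso_objective ::
  "real^'K^'m \<Rightarrow> real^'m \<Rightarrow> real \<Rightarrow> real^'K \<Rightarrow> real" where
  "lasso_objective C b \<alpha> x = 1/2 * (norm (C *v x - b))\<^sup>2 + \<alpha> * (\<Sum>i\<in>UNIV. \<bar>x $ i\<bar>)"

text \<open>
  \<open>Wm\<close> has the basis of the observation space as columns, \<open>D\<close> the dictionary. The vector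
  \<open>coords Wm w\<close> is the one denoted by a bold \<open>w\<close>.
\<close>

definition coords :: "real^'m^'n \<Rightarrow> real^'n \<Rightarrow> real^'m" where
  "coords Wm w = (THE b. Wm *v b = w)"

definition dict_objective ::
  "real^'n^'n \<Rightarrow> real^'m^'n \<Rightarrow> real^'K^'n \<Rightarrow> real^'n \<Rightarrow> real \<Rightarrow> real^'K \<Rightarrow> real" where
  "dict_objective R Wm D w = lasso_objective (transpose Wm ** R ** D) (coords Wm w)"

definition unique_lasso ::
  "real^'n^'n \<Rightarrow> real^'m^'n \<Rightarrow> real^'K^'n \<Rightarrow> real^'n \<Rightarrow> bool" where
  "unique_lasso R Wm D w \<longleftrightarrow>
     (\<forall>\<alpha>>0. \<exists>!x. is_arg_min (dict_objective R Wm D w \<alpha>) (\<lambda>_. True) x)"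

definition lasso_space ::
  "real^'n^'n \<Rightarrow> real^'m^'n \<Rightarrow> real^'K^'n \<Rightarrow> real^'n \<Rightarrow> real \<Rightarrow> (real^'n) set" where
  "lasso_space R Wm D w \<alpha> =
     (let x = arg_min (dict_objective R Wm D w \<alpha>) (\<lambda>_. True)
      in span {column i D | i. x $ i \<noteq> 0})"

text \<open>
  This is always a finite set, because each of its members is spanned by columns of \<open>D\<close>; hence
  \<open>card\<close> and \<open>Min\<close> have their usual meaning on it.
\<close>

definition lasso_library ::
  "real^'n^'n \<Rightarrow> real^'m^'n \<Rightarrow> real^'K^'n \<Rightarrow> (real^'n \<Rightarrow> real) \<Rightarrow> real^'n \<Rightarrow>
   (real^'n) set set" where
  "lasso_library R Wm D \<alpha>0 w = {lasso_space R Wm D w \<alpha> | \<alpha>. \<alpha> > \<alpha>0 w}"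

text \<open>
  The selected space need not be unique. This is the set of the recovered vectors over all the
  spaces that may be selected.
\<close>

definition dict_recovery ::
  "real^'n^'n \<Rightarrow> real^'n^'k \<Rightarrow> ('p \<Rightarrow> real^'n \<Rightarrow> real^'n) \<Rightarrow> ('p \<Rightarrow> real^'n) \<Rightarrow> 'p set \<Rightarrow>
   (real^'n) set \<Rightarrow> (real^'n) set set \<Rightarrow> real^'n \<Rightarrow> (real^'n) set" where
  "dict_recovery R \<Theta> B f Q W L w =
     {one_space_recovery R W V w | V.
        is_arg_min (\<lambda>V. sketched_dist R \<Theta> B f Q (one_space_recovery R W V w)) (\<lambda>V. V \<in> L) V}"


subsection \<open>Stability constant\<close>

definition inflate :: "real^'n^'n \<Rightarrow> (real^'n) set \<Rightarrow> real \<Rightarrow> (real^'n) set" where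
  "inflate R M \<sigma> = {v. distU R v M \<le> \<sigma>}"

definition diamU :: "real^'n^'n \<Rightarrow> (real^'n) set \<Rightarrow> ennreal" where
  "diamU R S = (SUP x\<in>S. SUP y\<in>S. ennreal (normU R (x - y)))"

definition stab_diam ::
  "real^'n^'n \<Rightarrow> (real^'n) set \<Rightarrow> (real^'n) set \<Rightarrow> real \<Rightarrow> ennreal" where
  "stab_diam R M W \<sigma> = (SUP w\<in>W. diamU R (inflate R M \<sigma> \<inter> {w + z | z. z \<in> orthU R W}))"

text \<open>
  The diameters are increasing in \<open>\<sigma>\<close>, so the truncation of the subtraction on \<open>ennreal\<close> has no
  effect. As \<open>\<infinity> - \<infinity> = \<infinity>\<close> on \<open>ennreal\<close>, the constant is infinite if some diameter is.
\<close>

definition stab_const :: "real^'n^'n \<Rightarrow> (real^'n) set \<Rightarrow> (real^'n) set \<Rightarrow> ennreal" where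
  "stab_const R M W =
     1/2 * (SUP \<sigma>\<in>{0<..}. (stab_diam R M W \<sigma> - stab_diam R M W 0) / ennreal \<sigma>)"

end

theory Submission
  imports Defs
begin

text \<open>
  Every vector that may be recovered from \<open>w\<close> lies in the affine space \<open>w + W\<^sup>\<bottom>\<close>, and so does \<open>u\<close>,
  because adding \<open>w - P\<^sub>W v\<close> to \<open>v\<close> corrects its component in \<open>W\<close> without touching the rest. The
  stability constant therefore turns any bound \<open>\<sigma>\<close> on the distance from a recovered vector \<open>a\<close> to the
  manifold into the bound \<open>\<delta>\<^sub>0 + 2\<mu>\<sigma>\<close> on \<open>\<parallel>u - a\<parallel>\<close> (\<open>error_le_stab_const\<close>).

  The residual \<open>B(\<xi>)v - f(\<xi>) = B(\<xi>)(v - u(\<xi>))\<close> is equivalent to \<open>v - u(\<xi>)\<close> up to the constants \<open>c\<close>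
  and \<open>C\<close>. If the sketch distorts the residuals of all candidates by factors in
  \<open>[\<surd>(1 - \<epsilon>), \<surd>(1 + \<epsilon>)]\<close> only, then the candidate that minimises the sketched residual is within
  \<open>\<kappa>\<^sup>\<Theta>\<close> times the error of the best candidate from the manifold (\<open>dist_of_sketched_minimiser\<close>);
  the comparison works because \<open>u\<close> itself is one of the solutions over which the residual is
  minimised.

  It remains to see that the sketch behaves this well often enough. The library of spaces does not
  depend on the sketch, so each candidate is a fixed vector. Its residuals are either finitely many,
  each on a line, or all contained in one space of dimension \<open>m\<^sub>B + m\<^sub>f + 1\<close>; in both cases the sketch
  fails on them with probability at most \<open>\<delta>\<close> (\<open>residual_embedding_finite\<close>,
  \<open>residual_embedding_affine\<close>), and a union bound over the library finishes the proof. As the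
  probability of a set that is not measurable has no meaning, the event of the theorem also has to
  be shown measurable; this uses that an infimum of continuous functions is upper semicontinuous.
\<close>


section \<open>The norms given by the Riesz matrix\<close>

lemma innerU_nonneg: "0 \<le> innerU R x x" if "spd R"
  using that by (cases "x = 0") (auto simp: spd_def innerU_def intro: less_imp_le)

lemma normU_nonneg: "0 \<le> normU R x" if "spd R"
  using innerU_nonneg[OF that] by (simp add: normU_def)

lemma normU_zero [simp]: "normU R 0 = 0"
  by (simp add: normU_def innerU_def)

lemma normU_pos: "0 < normU R x" if "spd R" "x \<noteq> 0"
  using that by (simp add: normU_def innerU_def spd_def)

lemma normU_minus_commute: "normU R (x - y) = normU R (y - x)"
proof -
  have "R *v (y - x) = - (R *v (x - y))"
    by (simp add: matrix_vector_mult_diff_distrib)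
  moreover have "y - x = - (x - y)" by simp
  ultimately have "innerU R (x - y) (x - y) = innerU R (y - x) (y - x)"
    unfolding innerU_def by (metis inner_minus_left inner_minus_right minus_minus)
  then show ?thesis by (simp add: normU_def)
qed

lemma spd_inverse_mult: "R *v (matrix_inv R *v r) = r" if "spd R"
proof -
  have "\<forall>x. R *v x = 0 \<longrightarrow> x = 0"
    using that by (metis inner_zero_right less_irrefl spd_def)
  then have "invertible R"
    by (simp add: invertible_left_inverse matrix_left_invertible_ker)
  then show ?thesis
    unfolding matrix_vector_mul_assoc invertible_def matrix_inv_def
    by (metis (mono_tags, lifting) matrix_vector_mul_lid someI_ex)
qed

text \<open>The inverse Riesz map is an isometry from the dual onto the space.\<close>

lemma norm_dual_eq_normU: "norm_dual R r = normU R (matrix_inv R *v r)" if "spd R"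
  by (simp add: norm_dual_def normU_def innerU_def spd_inverse_mult[OF that] inner_commute)

lemma bdd_below_normU: "bdd_below ((\<lambda>z. normU R (g z)) ` A)" if "spd R"
  using normU_nonneg[OF that] by (intro bdd_belowI2[where m = 0])

lemma distU_le: "distU R v M \<le> normU R (v - z)" if "spd R" "z \<in> M"
  unfolding distU_def using that by (intro cINF_lower bdd_below_normU)

lemma projU_unique:
  assumes "spd R" "subspace W" "p \<in> W" "x - p \<in> orthU R W" "q \<in> W" "x - q \<in> orthU R W"
  shows "q = p"
proof -
  have d: "q - p \<in> W" using assms by (simp add: subspace_diff)
  then have "innerU R (x - p) (q - p) = 0" "innerU R (x - q) (q - p) = 0"
    using assms by (auto simp: orthU_def)
  then have "innerU R (q - p) (q - p) = 0"
    by (simp add: innerU_def inner_diff_left)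
  then have "q - p = 0"
    using normU_pos[OF assms(1), of "q - p"] by (auto simp: normU_def)
  then show ?thesis by simp
qed

text \<open>
  The projection is \<open>p = W W\<^sup>T R x\<close> for a matrix \<open>W\<close> of orthonormal columns: \<open>W\<^sup>T R p = W\<^sup>T R x\<close>, so
  \<open>x - p\<close> is orthogonal to each column.
\<close>

lemma projU_works:
  fixes Wm :: "real^'m^'n"
  assumes "spd R" "subspace W" "span (columns Wm) = W" "transpose Wm ** R ** Wm = mat 1"
  shows "projU R W x \<in> W \<and> x - projU R W x \<in> orthU R W"
proof -
  define p where "p = Wm *v (transpose Wm *v (R *v x))"
  have range: "W = range ((*v) Wm)"
  proof
    have "columns Wm \<subseteq> range ((*v) Wm)"
      unfolding columns_def using matrix_vector_mult_basis[of Wm] by (auto intro: range_eqI[OF sym])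
    then show "W \<subseteq> range ((*v) Wm)"
      unfolding assms(3)[symmetric]
      by (intro span_minimal linear_subspace_image subspace_UNIV) auto
    show "range ((*v) Wm) \<subseteq> W"
      using matrix_vector_mult_in_columnspace[of Wm] assms(3) by auto
  qed
  have "transpose Wm *v (R *v p) = (transpose Wm ** R ** Wm) *v (transpose Wm *v (R *v x))"
    unfolding p_def by (simp only: matrix_vector_mul_assoc matrix_mul_assoc)
  then have normal_eq: "transpose Wm *v (R *v (x - p)) = 0"
    by (simp add: assms(4) matrix_vector_mult_diff_distrib)
  have "innerU R (x - p) (Wm *v b) = 0" for b
  proof -
    have "innerU R (x - p) (Wm *v b) = (transpose R *v (x - p)) \<bullet> (Wm *v b)"
      unfolding innerU_def by (simp add: dot_lmul_matrix)
    also have "\<dots> = (transpose Wm *v (R *v (x - p))) \<bullet> b"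
      using assms(1) by (simp add: spd_def dot_lmul_matrix)
    finally show ?thesis unfolding normal_eq by simp
  qed
  then have p: "p \<in> W \<and> x - p \<in> orthU R W"
    unfolding orthU_def range by (auto simp: p_def)
  show ?thesis
    unfolding projU_def by (rule theI[of "\<lambda>p. p \<in> W \<and> x - p \<in> orthU R W" p])
      (use p assms projU_unique in blast)+
qed


section \<open>From the distance to the manifold to the recovery error\<close>

lemma stab_diam_le:
  "stab_diam R M W \<sigma> \<le> stab_diam R M W 0 + 2 * stab_const R M W * ennreal \<sigma>"
  if "0 \<le> \<sigma>"
proof (cases "\<sigma> = 0")
  case False
  with that have \<sigma>: "0 < \<sigma>" by simp
  define S where "S = (SUP \<sigma>\<in>{0<..}. (stab_diam R M W \<sigma> - stab_diam R M W 0) / ennreal \<sigma>)"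
  have "(2::ennreal) * (1/2) = 1"
    by (simp add: ennreal_times_divide ennreal_divide_self)
  then have S: "2 * stab_const R M W = S"
    unfolding stab_const_def S_def by (simp only: mult.assoc[symmetric] mult_1)
  have "(stab_diam R M W \<sigma> - stab_diam R M W 0) / ennreal \<sigma> \<le> S"
    unfolding S_def using \<sigma> by (intro SUP_upper) auto
  then have "(stab_diam R M W \<sigma> - stab_diam R M W 0) / ennreal \<sigma> * ennreal \<sigma> \<le> S * ennreal \<sigma>"
    by (rule mult_right_mono) simp
  moreover have "x / ennreal \<sigma> * ennreal \<sigma> = x" for x
    using \<sigma> by (simp add: divide_ennreal_def mult.assoc ennreal_inverse_mult ennreal_mult'[symmetric]
        inverse_ennreal)
  ultimately have "stab_diam R M W \<sigma> - stab_diam R M W 0 \<le> S * ennreal \<sigma>"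
    by simp
  then show ?thesis
    unfolding S by (simp add: ennreal_minus_le_iff)
qed simp

text \<open>
  Both \<open>u\<close> and \<open>a\<close> belong to the \<open>\<sigma>\<close>-inflated manifold and to the same fibre of the observation map,
  so that their distance is at most \<open>\<delta>\<^sub>\<sigma>\<close>.
\<close>

lemma error_le_stab_const:
  assumes "spd R" "u \<in> M" "w \<in> W" "u - w \<in> orthU R W" "a - w \<in> orthU R W"
    and "0 \<le> \<sigma>" "distU R a M \<le> \<sigma>"
  shows "ennreal (normU R (u - a)) \<le> stab_diam R M W 0 + 2 * stab_const R M W * ennreal \<sigma>"
proof -
  let ?S = "inflate R M \<sigma> \<inter> {w + z | z. z \<in> orthU R W}"
  have "distU R u M \<le> 0"
    using distU_le[OF assms(1,2), of u] by simp
  then have "u \<in> inflate R M \<sigma>" "a \<in> inflate R M \<sigma>"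
    using assms by (auto simp: inflate_def)
  moreover have "\<exists>z. x = w + z \<and> z \<in> orthU R W" if "x - w \<in> orthU R W" for x
    using that by (intro exI[of _ "x - w"]) simp
  ultimately have "u \<in> ?S" "a \<in> ?S"
    using assms by auto
  then have "ennreal (normU R (u - a)) \<le> diamU R ?S"
    unfolding diamU_def by (meson SUP_upper SUP_upper2)
  also have "\<dots> \<le> stab_diam R M W \<sigma>"
    unfolding stab_diam_def by (rule SUP_upper) (rule assms)
  also note stab_diam_le[OF assms(6)]
  finally show ?thesis .
qed


section \<open>Residuals on a good sketch\<close>

lemma subspace_embedding_mono:
  "subspace_embedding R \<epsilon> T Y \<Longrightarrow> X \<subseteq> Y \<Longrightarrow> subspace_embedding R \<epsilon> T X"
  by (auto simp: subspace_embedding_def)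

lemma subspace_embedding_bounds:
  assumes "spd R" "0 \<le> \<epsilon>" "\<epsilon> < 1" "subspace_embedding R \<epsilon> T Y" "x \<in> Y"
  shows "norm (T *v x) \<le> sqrt (1 + \<epsilon>) * normU R x"
    and "sqrt (1 - \<epsilon>) * normU R x \<le> norm (T *v x)"
proof -
  have e: "\<bar>(normU R x)\<^sup>2 - (norm (T *v x))\<^sup>2\<bar> \<le> \<epsilon> * (normU R x)\<^sup>2"
    using assms by (auto simp: subspace_embedding_def)
  have "(norm (T *v x))\<^sup>2 \<le> (1 + \<epsilon>) * (normU R x)\<^sup>2"
    using e by (simp add: algebra_simps)
  then have "sqrt ((norm (T *v x))\<^sup>2) \<le> sqrt ((1 + \<epsilon>) * (normU R x)\<^sup>2)"
    by (rule real_sqrt_le_mono)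
  then show "norm (T *v x) \<le> sqrt (1 + \<epsilon>) * normU R x"
    by (simp add: real_sqrt_mult normU_nonneg[OF assms(1)])
  have "(1 - \<epsilon>) * (normU R x)\<^sup>2 \<le> (norm (T *v x))\<^sup>2"
    using e by (simp add: algebra_simps)
  then have "sqrt ((1 - \<epsilon>) * (normU R x)\<^sup>2) \<le> sqrt ((norm (T *v x))\<^sup>2)"
    by (rule real_sqrt_le_mono)
  then show "sqrt (1 - \<epsilon>) * normU R x \<le> norm (T *v x)"
    by (simp add: real_sqrt_mult normU_nonneg[OF assms(1)])
qed

text \<open>
  The residuals of a vector \<open>v\<close> as elements of the space itself, where the sketch acts on them.
\<close>

definition riesz_residuals ::
  "real^'n^'n \<Rightarrow> ('p \<Rightarrow> real^'n \<Rightarrow> real^'n) \<Rightarrow> ('p \<Rightarrow> real^'n) \<Rightarrow> 'p set \<Rightarrow> real^'n \<Rightarrow> (real^'n) set"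
where
  "riesz_residuals R B f Q v = (\<lambda>\<xi>. matrix_inv R *v (B \<xi> v - f \<xi>)) ` Q"

lemma sketched_dist_le:
  "sketched_dist R T B f Q v \<le> norm (T *v (matrix_inv R *v (B \<xi> v - f \<xi>)))" if "\<xi> \<in> Q"
  unfolding sketched_dist_def sketched_norm_dual_def
  using that by (intro cINF_lower bdd_belowI2[where m = 0]) auto

text \<open>
  The upper bound evaluates the sketched distance of the competitor \<open>b\<close> at the parameter of \<open>u\<close>
  only. The lower bound holds at all parameters in \<open>Q\<close>, hence for the infimum, and the solutions with
  parameters in \<open>Q\<close> are part of the manifold.
\<close>

lemma dist_of_sketched_minimiser:
  fixes B :: "'p \<Rightarrow> real^'n \<Rightarrow> real^'n" and T :: "real^'n^'k"
  assumes R: "spd R" and \<epsilon>: "0 \<le> \<epsilon>" "\<epsilon> < 1" and c: "0 < c" "c \<le> C"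
    and Q: "Q \<subseteq> P" and u: "u \<in> sol ` Q"
    and sol: "\<And>\<xi>. \<xi> \<in> P \<Longrightarrow> B \<xi> (sol \<xi>) = f \<xi>"
    and lin: "\<And>\<xi>. \<xi> \<in> P \<Longrightarrow> linear (B \<xi>)"
    and bounds: "\<And>\<xi> v. \<xi> \<in> P \<Longrightarrow> v \<noteq> 0 \<Longrightarrow>
           c \<le> norm_dual R (B \<xi> v) / normU R v \<and> norm_dual R (B \<xi> v) / normU R v \<le> C"
    and emb: "subspace_embedding R \<epsilon> T (riesz_residuals R B f Q a)"
             "subspace_embedding R \<epsilon> T (riesz_residuals R B f Q b)"
    and le: "sketched_dist R T B f Q a \<le> sketched_dist R T B f Q b"
  shows "distU R a (sol ` P) \<le> C / c * sqrt (1 + \<epsilon>) / sqrt (1 - \<epsilon>) * normU R (u - b)"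
proof -
  define res where "res v \<xi> = matrix_inv R *v (B \<xi> v - f \<xi>)" for v \<xi>
  have res_mem: "res v \<xi> \<in> riesz_residuals R B f Q v" if "\<xi> \<in> Q" for v \<xi>
    using that by (auto simp: riesz_residuals_def res_def)
  have res: "c * normU R (v - sol \<xi>) \<le> normU R (res v \<xi>) \<and>
      normU R (res v \<xi>) \<le> C * normU R (v - sol \<xi>)" if \<xi>: "\<xi> \<in> P" for v \<xi>
  proof -
    have eq: "normU R (res v \<xi>) = norm_dual R (B \<xi> (v - sol \<xi>))"
      using sol[OF \<xi>] linear_diff[OF lin[OF \<xi>]] by (simp add: res_def norm_dual_eq_normU[OF R])
    show ?thesis
    proof (cases "v - sol \<xi> = 0")
      case True
      then show ?thesis
        unfolding eq True using linear_0[OF lin[OF \<xi>]] by (simp add: norm_dual_def)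
    next
      case False
      with bounds[OF \<xi> False] normU_pos[OF R False] show ?thesis
        unfolding eq by (simp add: field_simps)
    qed
  qed
  obtain \<xi>u where \<xi>u: "\<xi>u \<in> Q" "u = sol \<xi>u" using u by blast
  have upper: "sketched_dist R T B f Q b \<le> sqrt (1 + \<epsilon>) * (C * normU R (u - b))"
  proof -
    have "sketched_dist R T B f Q b \<le> norm (T *v res b \<xi>u)"
      unfolding res_def by (rule sketched_dist_le) (rule \<xi>u)
    also have "\<dots> \<le> sqrt (1 + \<epsilon>) * normU R (res b \<xi>u)"
      by (rule subspace_embedding_bounds(1)[OF R \<epsilon> emb(2) res_mem]) (rule \<xi>u)
    also have "\<dots> \<le> sqrt (1 + \<epsilon>) * (C * normU R (u - b))"
      using res[of \<xi>u b] \<xi>u Q \<epsilon> by (intro mult_left_mono) (auto simp: normU_minus_commute[of R "sol \<xi>u" b])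
    finally show ?thesis .
  qed
  have lower: "sqrt (1 - \<epsilon>) * (c * distU R a (sol ` P)) \<le> sketched_dist R T B f Q a"
    unfolding sketched_dist_def sketched_norm_dual_def
  proof (rule cINF_greatest)
    show "Q \<noteq> {}" using \<xi>u by auto
    fix \<xi> assume \<xi>: "\<xi> \<in> Q"
    then have "c * distU R a (sol ` P) \<le> c * normU R (a - sol \<xi>)"
      using c Q by (intro mult_left_mono distU_le R) auto
    also have "\<dots> \<le> normU R (res a \<xi>)" using res \<xi> Q by auto
    finally have "sqrt (1 - \<epsilon>) * (c * distU R a (sol ` P)) \<le> sqrt (1 - \<epsilon>) * normU R (res a \<xi>)"
      using \<epsilon> by (intro mult_left_mono) auto
    also have "\<dots> \<le> norm (T *v res a \<xi>)"
      by (rule subspace_embedding_bounds(2)[OF R \<epsilon> emb(1) res_mem[OF \<xi>]])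
    finally show "sqrt (1 - \<epsilon>) * (c * distU R a (sol ` P))
        \<le> norm (T *v (matrix_inv R *v (B \<xi> a - f \<xi>)))"
      by (simp add: res_def)
  qed
  have "sqrt (1 - \<epsilon>) * (c * distU R a (sol ` P)) \<le> sqrt (1 + \<epsilon>) * (C * normU R (u - b))"
    using lower le upper by linarith
  moreover have "0 < sqrt (1 - \<epsilon>)" using \<epsilon> by simp
  ultimately show ?thesis using c by (simp add: field_simps)
qed


section \<open>Measurability\<close>

lemma borel_measurable_cINF_continuous:
  fixes h :: "'p \<Rightarrow> 'a::topological_space \<Rightarrow> real"
  assumes "Q \<noteq> {}" "\<And>\<xi>. \<xi> \<in> Q \<Longrightarrow> continuous_on UNIV (h \<xi>)" "\<And>\<xi> x. 0 \<le> h \<xi> x"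
  shows "(\<lambda>x. INF \<xi>\<in>Q. h \<xi> x) \<in> borel_measurable borel"
proof (rule borel_measurableI_less)
  fix y
  have "{x. (INF \<xi>\<in>Q. h \<xi> x) < y} = (\<Union>\<xi>\<in>Q. {x. h \<xi> x < y})"
    using assms by (subst cINF_less_iff) (auto intro!: bdd_belowI2[where m = 0])
  moreover have "open (\<Union>\<xi>\<in>Q. {x. h \<xi> x < y})"
    using assms by (intro open_UN ballI open_Collect_less) auto
  ultimately show "{x \<in> space borel. (INF \<xi>\<in>Q. h \<xi> x) < y} \<in> sets borel"
    by simp
qed

lemma continuous_on_matrix_vector_mult_left:
  "continuous_on A (\<lambda>T :: real^'n^'k. T *v x)"
  unfolding matrix_vector_mult_def by (intro continuous_intros)

lemma borel_measurable_sketched_dist: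
  fixes \<Theta> :: "'w \<Rightarrow> real^'n^'k"
  assumes "Q \<noteq> {}" "\<Theta> \<in> borel_measurable Pr"
  shows "(\<lambda>\<omega>. sketched_dist R (\<Theta> \<omega>) B f Q v) \<in> borel_measurable Pr"
proof -
  have "(\<lambda>T :: real^'n^'k. sketched_dist R T B f Q v) \<in> borel_measurable borel"
    unfolding sketched_dist_def sketched_norm_dual_def
    using assms by (intro borel_measurable_cINF_continuous continuous_intros
        continuous_on_matrix_vector_mult_left) auto
  with assms(2) show ?thesis by (rule measurable_compose)
qed

lemma sets_subspace_embedding:
  fixes \<Theta> :: "'w \<Rightarrow> real^'n^'k"
  assumes "\<Theta> \<in> borel_measurable Pr"
  shows "{\<omega> \<in> space Pr. subspace_embedding R \<epsilon> (\<Theta> \<omega>) Y} \<in> sets Pr"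
proof -
  have "closed {T :: real^'n^'k. subspace_embedding R \<epsilon> T Y}"
    unfolding subspace_embedding_def Ball_def
    by (intro closed_Collect_all closed_Collect_imp open_Collect_const closed_Collect_le
        continuous_intros continuous_on_matrix_vector_mult_left)
  then have "{T :: real^'n^'k. subspace_embedding R \<epsilon> T Y} \<in> sets borel"
    by (rule borel_closed)
  from measurable_sets[OF assms this] show ?thesis
    by (simp add: vimage_def Int_def conj_commute)
qed


section \<open>Probability of a good sketch\<close>

lemma (in prob_space) prob_ball_ge:
  assumes "finite I" "\<And>i. i \<in> I \<Longrightarrow> {\<omega> \<in> space M. A i \<omega>} \<in> events"
    and "\<And>i. i \<in> I \<Longrightarrow> 1 - \<eta> \<le> prob {\<omega> \<in> space M. A i \<omega>}"
  shows "1 - real (card I) * \<eta> \<le> prob {\<omega> \<in> space M. \<forall>i\<in>I. A i \<omega>}"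
proof -
  let ?N = "\<lambda>i. space M - {\<omega> \<in> space M. A i \<omega>}"
  have "prob (\<Union>i\<in>I. ?N i) \<le> (\<Sum>i\<in>I. prob (?N i))"
    using assms by (intro finite_measure_subadditive_finite) auto
  also have "\<dots> \<le> (\<Sum>i\<in>I. \<eta>)"
    using assms by (intro sum_mono) (auto simp: prob_compl algebra_simps)
  finally have N: "prob (\<Union>i\<in>I. ?N i) \<le> real (card I) * \<eta>" by simp
  have "{\<omega> \<in> space M. \<forall>i\<in>I. A i \<omega>} = space M - (\<Union>i\<in>I. ?N i)" by auto
  moreover have "(\<Union>i\<in>I. ?N i) \<in> events" using assms by (intro sets.finite_UN) auto
  ultimately show ?thesis using N by (simp add: prob_compl)
qed

lemma superspace_of_dim:
  fixes S :: "'a::euclidean_space set"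
  assumes "dim S \<le> d" "d \<le> DIM('a)"
  obtains Y where "subspace Y" "dim Y = d" "S \<subseteq> Y"
proof -
  from assms have "\<exists>Y. subspace Y \<and> dim Y = d \<and> S \<subseteq> Y"
  proof (induction rule: dec_induct)
    case base
    show ?case by (intro exI[of _ "span S"]) (auto simp: span_superset)
  next
    case (step n)
    then obtain Y where Y: "subspace Y" "dim Y = n" "S \<subseteq> Y" by auto
    have "Y \<noteq> UNIV" using Y step by auto
    then obtain x where "x \<notin> span Y" using Y by (metis UNIV_eq_I span_eq_iff)
    then show ?case
      using Y by (intro exI[of _ "span (insert x Y)"])
        (auto simp: dim_insert intro: span_base)
  qed
  with that show thesis by blast
qed

text \<open>
  An oblivious embedding is only required to be good on spaces of dimension exactly \<open>d\<close>; a set of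
  smaller dimension is enlarged to such a space first.
\<close>

lemma oblivious_embedding_prob:
  fixes \<Theta> :: "'w \<Rightarrow> real^'n^'k" and R :: "real^'n^'n"
  assumes "prob_space Pr" "\<Theta> \<in> borel_measurable Pr" "oblivious_embedding R Pr \<Theta> \<epsilon> \<delta> d"
    and "dim S \<le> d"
  shows "1 - \<delta> \<le> \<P>(\<omega> in Pr. subspace_embedding R \<epsilon> (\<Theta> \<omega>) S)"
proof -
  interpret prob_space Pr by fact
  have "d \<le> DIM(real^'n)" using assms(3) by (simp add: oblivious_embedding_def)
  then obtain Y where Y: "subspace Y" "dim Y = d" "S \<subseteq> Y"
    using superspace_of_dim assms(4) by blast
  have "1 - \<delta> \<le> \<P>(\<omega> in Pr. subspace_embedding R \<epsilon> (\<Theta> \<omega>) Y)"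
    using assms(3) Y by (simp add: oblivious_embedding_def)
  also have "\<dots> \<le> \<P>(\<omega> in Pr. subspace_embedding R \<epsilon> (\<Theta> \<omega>) S)"
    using subspace_embedding_mono[OF _ Y(3)] assms(2)
    by (intro finite_measure_mono sets_subspace_embedding) auto
  finally show ?thesis .
qed

lemma residual_embedding_finite:
  fixes \<Theta> :: "'w \<Rightarrow> real^'n^'k" and R :: "real^'n^'n"
  assumes "prob_space Pr" "\<Theta> \<in> borel_measurable Pr" "finite Q" "Q \<noteq> {}"
    and "oblivious_embedding R Pr \<Theta> \<epsilon> (inverse (real (card Q)) * \<delta>) 1"
  shows "1 - \<delta> \<le> \<P>(\<omega> in Pr. subspace_embedding R \<epsilon> (\<Theta> \<omega>) (riesz_residuals R B f Q v))"
proof -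
  interpret prob_space Pr by fact
  let ?E = "\<lambda>\<xi> \<omega>. subspace_embedding R \<epsilon> (\<Theta> \<omega>) {matrix_inv R *v (B \<xi> v - f \<xi>)}"
  have "1 - real (card Q) * (inverse (real (card Q)) * \<delta>) \<le> \<P>(\<omega> in Pr. \<forall>\<xi>\<in>Q. ?E \<xi> \<omega>)"
  proof (rule prob_ball_ge)
    fix \<xi>
    show "{\<omega> \<in> space Pr. ?E \<xi> \<omega>} \<in> events"
      by (rule sets_subspace_embedding) fact
    show "1 - inverse (real (card Q)) * \<delta> \<le> prob {\<omega> \<in> space Pr. ?E \<xi> \<omega>}"
      using assms dim_le_card'[of "{matrix_inv R *v (B \<xi> v - f \<xi>)}"]
      by (intro oblivious_embedding_prob) auto
  qed fact
  then show ?thesis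
    using assms(3,4) by (simp add: subspace_embedding_def riesz_residuals_def field_simps)
qed

text \<open>
  For a fixed \<open>v\<close>, the residuals are combinations of \<open>B\<^sup>(\<^sup>0\<^sup>)v - f\<^sup>(\<^sup>0\<^sup>)\<close> and of the \<open>m\<^sub>B + m\<^sub>f\<close> vectors
  \<open>B\<^sup>(\<^sup>q\<^sup>)v\<close> and \<open>f\<^sup>(\<^sup>q\<^sup>)\<close>, none of which depends on the parameter.
\<close>

lemma dim_riesz_residuals_affine:
  fixes R :: "real^'n^'n"
  assumes "affine_parametrization P B f mB mf"
  shows "dim (riesz_residuals R B f P v) \<le> mB + mf + 1"
proof -
  from assms obtain Bq fq \<theta>B \<theta>f where par: "\<And>\<xi>. \<xi> \<in> P \<Longrightarrow>
      (\<forall>v. B \<xi> v = Bq 0 v + (\<Sum>q=1..mB. \<theta>B q \<xi> *\<^sub>R Bq q v)) \<and>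
      f \<xi> = fq 0 + (\<Sum>q=1..mf. \<theta>f q \<xi> *\<^sub>R fq q)"
    unfolding affine_parametrization_def by blast
  let ?g = "(*v) (matrix_inv R)"
  let ?X = "(\<lambda>q. Bq q v) ` {1..mB}" and ?Y = "fq ` {1..mf}"
  let ?S = "insert (Bq 0 v - fq 0) (?X \<union> ?Y)"
  have "B \<xi> v - f \<xi> \<in> span ?S" if \<xi>: "\<xi> \<in> P" for \<xi>
  proof -
    have "B \<xi> v - f \<xi> = (Bq 0 v - fq 0) + (\<Sum>q=1..mB. \<theta>B q \<xi> *\<^sub>R Bq q v)
        - (\<Sum>q=1..mf. \<theta>f q \<xi> *\<^sub>R fq q)"
      using par[OF \<xi>] by simp
    also have "\<dots> \<in> span ?S"
      by (rule span_diff, rule span_add)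
        (blast intro: span_base span_sum span_scale)+
    finally show ?thesis .
  qed
  then have "riesz_residuals R B f P v \<subseteq> ?g ` span ?S"
    by (auto simp: riesz_residuals_def)
  then have "dim (riesz_residuals R B f P v) \<le> dim (?g ` span ?S)"
    by (rule dim_subset)
  also have "\<dots> \<le> dim (span ?S)"
    by (rule dim_image_le) simp
  also have "\<dots> \<le> card ?S"
    by (simp add: dim_le_card')
  also have "\<dots> \<le> Suc (card ?X + card ?Y)"
    using card_Un_le[of ?X ?Y] by (simp add: card_insert_if)
  also have "\<dots> \<le> mB + mf + 1"
    using card_image_le[of "{1..mB}" "\<lambda>q. Bq q v"] card_image_le[of "{1..mf}" fq] by simp
  finally show ?thesis .
qed

lemma residual_embedding_affine:
  fixes \<Theta> :: "'w \<Rightarrow> real^'n^'k" and R :: "real^'n^'n"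
  assumes "prob_space Pr" "\<Theta> \<in> borel_measurable Pr" "affine_parametrization P B f mB mf"
    and "oblivious_embedding R Pr \<Theta> \<epsilon> \<delta> (mB + mf + 1)"
  shows "1 - \<delta> \<le> \<P>(\<omega> in Pr. subspace_embedding R \<epsilon> (\<Theta> \<omega>) (riesz_residuals R B f P v))"
  using assms dim_riesz_residuals_affine by (intro oblivious_embedding_prob)


section \<open>Recovery from a library of spaces\<close>

lemma one_space_recovery_fibre:
  fixes Wm :: "real^'m^'n"
  assumes "spd R" "subspace W" "span (columns Wm) = W" "transpose Wm ** R ** Wm = mat 1"
  shows "one_space_recovery R W V w - w \<in> orthU R W"
  using projU_works[OF assms] by (simp add: one_space_recovery_def Let_def)

lemma finite_lasso_library: "finite (lasso_library R Wm D \<alpha>0 w)"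
proof -
  have "lasso_library R Wm D \<alpha>0 w \<subseteq> (\<lambda>I. span ((\<lambda>i. column i D) ` I)) ` UNIV"
  proof
    fix V assume "V \<in> lasso_library R Wm D \<alpha>0 w"
    then obtain x :: "real^'c" where "V = span {column i D | i. x $ i \<noteq> 0}"
      by (auto simp: lasso_library_def lasso_space_def Let_def)
    also have "{column i D | i. x $ i \<noteq> 0} = (\<lambda>i. column i D) ` {i. x $ i \<noteq> 0}" by auto
    finally show "V \<in> (\<lambda>I. span ((\<lambda>i. column i D) ` I)) ` UNIV" by blast
  qed
  then show ?thesis by (rule finite_subset) simp
qed

lemma lasso_library_nonempty: "lasso_library R Wm D \<alpha>0 w \<noteq> {}"
  using gt_ex[of "\<alpha>0 w"] by (auto simp: lasso_library_def)

text \<open>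
  Whether a space is selected is decided by finitely many comparisons of random variables, and the
  property \<open>G\<close> of the recovered vector does not depend on the sketch.
\<close>

lemma sets_dict_recovery:
  fixes \<Theta> :: "'w \<Rightarrow> real^'n^'k"
  assumes "finite L" "Q \<noteq> {}" "\<Theta> \<in> borel_measurable Pr"
  shows "{\<omega> \<in> space Pr. \<forall>a\<in>dict_recovery R (\<Theta> \<omega>) B f Q W L w. G a} \<in> sets Pr"
proof -
  let ?s = "\<lambda>V \<omega>. sketched_dist R (\<Theta> \<omega>) B f Q (one_space_recovery R W V w)"
  have [measurable]: "?s V \<in> borel_measurable Pr" for V
    by (rule borel_measurable_sketched_dist[OF assms(2,3)])
  have "{\<omega> \<in> space Pr. \<forall>a\<in>dict_recovery R (\<Theta> \<omega>) B f Q W L w. G a} =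
      {\<omega> \<in> space Pr. \<forall>V\<in>L. (\<forall>V'\<in>L. \<not> ?s V' \<omega> < ?s V \<omega>) \<longrightarrow> G (one_space_recovery R W V w)}"
    by (auto simp: dict_recovery_def is_arg_min_def)
  also have "\<dots> \<in> sets Pr"
    using assms(1) by measurable
  finally show ?thesis .
qed

theorem corollary5p2:
  fixes R :: "real^'n^'n"
    and W :: "(real^'n) set" and Wm :: "real^'m^'n"
    and P Q :: "'p set"
    and B :: "'p \<Rightarrow> real^'n \<Rightarrow> real^'n" and f sol :: "'p \<Rightarrow> real^'n"
    and D :: "real^'K^'n" and \<alpha>0 :: "real^'n \<Rightarrow> real" and N\<^sub>L\<^sub>A\<^sub>R\<^sub>S :: nat
    and Pr :: "'w measure" and \<Theta> :: "'w \<Rightarrow> real^'n^'k"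
    and c C \<epsilon> \<delta> :: real and mB mf :: nat
    and u w :: "real^'n"
  defines "M \<equiv> sol ` P"
  defines "L \<equiv> lasso_library R Wm D \<alpha>0"
  defines "\<kappa>\<Theta> \<equiv> C / c * sqrt (1 + \<epsilon>) / sqrt (1 - \<epsilon>)"
  assumes "spd R"
    and "subspace W" and "dim W = CARD('m)"
    and "span (columns Wm) = W" and "transpose Wm ** R ** Wm = mat 1"
    and "P \<noteq> {}"
    and "\<And>\<xi>. \<xi> \<in> P \<Longrightarrow> B \<xi> (sol \<xi>) = f \<xi>"
    and "\<And>i. normU R (column i D) = 1"
    and "\<And>w. w \<in> W \<Longrightarrow> unique_lasso R Wm D w"
    and "\<And>w. w \<in> W \<Longrightarrow> \<alpha>0 w > 0"
    and "\<And>w. w \<in> W \<Longrightarrow> card (L w) \<le> N\<^sub>L\<^sub>A\<^sub>R\<^sub>S"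
    and "prob_space Pr" and "\<Theta> \<in> borel_measurable Pr"
    and "0 \<le> \<epsilon>" and "\<epsilon> < 1"
    and "stab_const R M W < \<infinity>"
    and "0 < c" and "c \<le> C"
    and "\<And>\<xi>. \<xi> \<in> P \<Longrightarrow> linear (B \<xi>)"
    and "\<And>\<xi> v. \<xi> \<in> P \<Longrightarrow> v \<noteq> 0 \<Longrightarrow>
           c \<le> norm_dual R (B \<xi> v) / normU R v \<and> norm_dual R (B \<xi> v) / normU R v \<le> C"
    and "(Q \<subseteq> P \<and> finite Q \<and> oblivious_embedding R Pr \<Theta> \<epsilon> (inverse (real (card Q)) * \<delta>) 1) \<or>
         (Q = P \<and> affine_parametrization P B f mB mf \<and>
          oblivious_embedding R Pr \<Theta> \<epsilon> \<delta> (mB + mf + 1))"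
    and "u \<in> sol ` Q" and "w = projU R W u"
  shows "\<P>(\<omega> in Pr. \<forall>a \<in> dict_recovery R (\<Theta> \<omega>) B f Q W (L w) w.
            ennreal (normU R (u - a))
              \<le> stab_diam R M W 0 + 2 * ennreal \<kappa>\<Theta> * stab_const R M W *
                 ennreal (Min ((\<lambda>V. normU R (u - one_space_recovery R W V w)) ` L w)))
         \<ge> 1 - \<delta> * real N\<^sub>L\<^sub>A\<^sub>R\<^sub>S"
proof -
  note R = \<open>spd R\<close> and \<Theta> = \<open>\<Theta> \<in> borel_measurable Pr\<close> and \<epsilon> = \<open>0 \<le> \<epsilon>\<close> \<open>\<epsilon> < 1\<close>
  note basis = \<open>spd R\<close> \<open>subspace W\<close> \<open>span (columns Wm) = W\<close> \<open>transpose Wm ** R ** Wm = mat 1\<close>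
  note cases = \<open>(Q \<subseteq> P \<and> finite Q \<and> _) \<or> _\<close>
  interpret prob_space Pr by fact
  have Q: "Q \<subseteq> P" "Q \<noteq> {}" using cases \<open>u \<in> sol ` Q\<close> by auto
  have w: "w \<in> W" "u - w \<in> orthU R W"
    using projU_works[OF basis, of u] \<open>w = projU R W u\<close> by auto
  have L: "finite (L w)" "L w \<noteq> {}"
    unfolding L_def by (rule finite_lasso_library lasso_library_nonempty)+
  define A where "A V = one_space_recovery R W V w" for V
  define E where
    "E V \<omega> \<longleftrightarrow> subspace_embedding R \<epsilon> (\<Theta> \<omega>) (riesz_residuals R B f Q (A V))" for V \<omega>
  define G where "G a \<longleftrightarrow> ennreal (normU R (u - a)) \<le> stab_diam R M W 0 +
    2 * ennreal \<kappa>\<Theta> * stab_const R M W * ennreal (Min ((\<lambda>V. normU R (u - A V)) ` L w))" for a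

  have E_sets: "{\<omega> \<in> space Pr. E V \<omega>} \<in> events" for V
    unfolding E_def by (rule sets_subspace_embedding[OF \<Theta>])
  have E_prob: "1 - \<delta> \<le> prob {\<omega> \<in> space Pr. E V \<omega>}" for V
    unfolding E_def using cases
  proof
    assume "Q \<subseteq> P \<and> finite Q \<and>
      oblivious_embedding R Pr \<Theta> \<epsilon> (inverse (real (card Q)) * \<delta>) 1"
    then show "1 - \<delta> \<le> \<P>(\<omega> in Pr. subspace_embedding R \<epsilon> (\<Theta> \<omega>) (riesz_residuals R B f Q (A V)))"
      using prob_space_axioms \<Theta> Q by (intro residual_embedding_finite) auto
  next
    assume "Q = P \<and> affine_parametrization P B f mB mf \<and>
      oblivious_embedding R Pr \<Theta> \<epsilon> \<delta> (mB + mf + 1)"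
    then show "1 - \<delta> \<le> \<P>(\<omega> in Pr. subspace_embedding R \<epsilon> (\<Theta> \<omega>) (riesz_residuals R B f Q (A V)))"
      using prob_space_axioms \<Theta> by (auto intro: residual_embedding_affine)
  qed

  have good: "G a" if E: "\<forall>V\<in>L w. E V \<omega>" and a: "a \<in> dict_recovery R (\<Theta> \<omega>) B f Q W (L w) w"
    for a \<omega>
  proof -
    define m where "m = Min ((\<lambda>V. normU R (u - A V)) ` L w)"
    have "m \<in> (\<lambda>V. normU R (u - A V)) ` L w"
      unfolding m_def using L by (intro Min_in) auto
    then obtain V' where V': "V' \<in> L w" "m = normU R (u - A V')" by auto
    obtain V where V: "V \<in> L w" "a = A V"
      and min: "sketched_dist R (\<Theta> \<omega>) B f Q (A V) \<le> sketched_dist R (\<Theta> \<omega>) B f Q (A V')"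
      using a V'(1) by (auto simp: dict_recovery_def is_arg_min_linorder A_def)
    have "distU R a M \<le> \<kappa>\<Theta> * m"
      unfolding M_def \<kappa>\<Theta>_def V'(2) V(2)
    proof (rule dist_of_sketched_minimiser[where B = B and f = f and T = "\<Theta> \<omega>" and Q = Q])
      show "subspace_embedding R \<epsilon> (\<Theta> \<omega>) (riesz_residuals R B f Q (A V))"
        "subspace_embedding R \<epsilon> (\<Theta> \<omega>) (riesz_residuals R B f Q (A V'))"
        using E V(1) V'(1) by (auto simp: E_def)
      show "Q \<subseteq> P" "sketched_dist R (\<Theta> \<omega>) B f Q (A V) \<le> sketched_dist R (\<Theta> \<omega>) B f Q (A V')"
        by (fact Q(1)) (fact min)
    qed fact+
    moreover have \<kappa>: "0 \<le> \<kappa>\<Theta>"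
      unfolding \<kappa>\<Theta>_def using \<epsilon> \<open>0 < c\<close> \<open>c \<le> C\<close> by simp
    moreover have m: "0 \<le> m" using V'(2) normU_nonneg[OF R] by simp
    moreover have "u \<in> M" using \<open>u \<in> sol ` Q\<close> Q unfolding M_def by auto
    moreover have "a - w \<in> orthU R W"
      unfolding V(2) A_def by (rule one_space_recovery_fibre[OF basis])
    ultimately have "ennreal (normU R (u - a))
        \<le> stab_diam R M W 0 + 2 * stab_const R M W * ennreal (\<kappa>\<Theta> * m)"
      using R w by (intro error_le_stab_const) auto
    then show ?thesis
      unfolding G_def m_def[symmetric] using \<kappa> m by (simp add: ennreal_mult mult_ac)
  qed

  (* A negative failure probability would contradict E_prob, so that enlarging the size of the
     library to its bound can only weaken the estimate. *)
  have "0 \<le> \<delta>" using order_trans[OF E_prob prob_le_1] by simp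
  then have "\<delta> * real (card (L w)) \<le> \<delta> * real N\<^sub>L\<^sub>A\<^sub>R\<^sub>S"
    using \<open>\<And>w. w \<in> W \<Longrightarrow> card (L w) \<le> N\<^sub>L\<^sub>A\<^sub>R\<^sub>S\<close>[OF w(1)] by (intro mult_left_mono) auto
  then have "1 - \<delta> * real N\<^sub>L\<^sub>A\<^sub>R\<^sub>S \<le> 1 - real (card (L w)) * \<delta>"
    by (simp add: mult.commute)
  also have "\<dots> \<le> prob {\<omega> \<in> space Pr. \<forall>V\<in>L w. E V \<omega>}"
    by (rule prob_ball_ge[OF L(1) E_sets E_prob])
  also have "\<dots> \<le> prob {\<omega> \<in> space Pr. \<forall>a\<in>dict_recovery R (\<Theta> \<omega>) B f Q W (L w) w. G a}"
    using good by (intro finite_measure_mono sets_dict_recovery L Q \<Theta>) auto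
  finally show ?thesis unfolding G_def A_def .
qed

end
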